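(* Let $(a_j)_{j\in\mathbb{N}}$ be real numbers, not all zero, with $\sum_{j\in\mathbb{N}}|a_j|<\infty$, and let $f\in C^2(\mathbb{R}_+,\mathbb{R})$, $\mathbb{R}_+=[0,\infty)$, with $f(0)=0$. Suppose there are $\bar r_1\in(0,1)$, $\nu\in\Phi(\mathbb{R}\setminus\{0\})\setminus\{0\}$ and $T>0$ such that all solutions $k_1,k_2,\dots,k_{m_1}\in\mathbb{Z}$ of the equation $$-\nu=\Phi\!\left(\tfrac{2\pi}{T}(\bar r_1+k)\right)$$ are either all nonnegative or all negative, and $m_1>0$. Then for any small $\varepsilon>0$ there are $m_1$ branches of nonzero quasi periodic traveling wave solutions $$u_{n,j,\varepsilon}(t)=U_{j,\varepsilon}(n-\nu_\varepsilon t),\qquad j=1,2,\dots,m_1,$$ of $$\imath\,\dot u_n=\sum_{l\in\mathbb{N}}a_l\,(u_{n+l}+u_{n-l}-2u_n)+f(|u_n|^2)u_n,\qquad n\in\mathbb{Z},\ u_n\in\mathbb{C},$$ with $U_{j,\varepsilon}\in C^1(\mathbb{R},\mathbb{C})$, $j=1,2,\dots,m_1$, and nonzero velocity $\nu_\varepsilon$, satisfying $$U_{j,\varepsilon}(z+T)=e^{2\pi\bar r_1\imath}\,U_{j,\varepsilon}(z)\quad\text{for all }z\in\mathbb{R},$$ along with $\nu_\varepsilon\to\nu$ and $U_{j,\varepsilon}\to0$ uniformly on $\mathbb{R}$ as $\varepsilon\to0$.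
   Context: $\mathbb{N}=\{1,2,\dots\}$ and $\imath$ is the imaginary unit. The function $\Phi:\mathbb{R}\setminus\{0\}\to\mathbb{R}$ is $$\Phi(x)=\frac{4}{x}\sum_{j\in\mathbb{N}}a_j\sin^2\!\left(\frac{xj}{2}\right).$$ *)

theory Defs
  imports "HOL-Analysis.Analysis"
begin

text \<open>Sequences \<open>(a\<^sub>j)\<close> indexed by the positive integers are functions on \<open>nat\<close>;
  the value at \<open>0\<close> is never used.\<close>

definition Phi :: "(nat \<Rightarrow> real) \<Rightarrow> real \<Rightarrow> real" where
  "Phi a x = 4 / x * (\<Sum>\<^sub>\<infinity>j\<in>{1..}. a j * (sin (x * real j / 2))\<^sup>2)"

text \<open>\<open>f \<in> C\<^sup>2([0,\<infinity>), \<real>)\<close>, with one-sided derivatives at \<open>0\<close>; values of \<open>f\<close> at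
  negative arguments are irrelevant.\<close>

definition C2_on_nonneg :: "(real \<Rightarrow> real) \<Rightarrow> bool" where
  "C2_on_nonneg f \<longleftrightarrow>
     (\<exists>f' f''. (\<forall>x\<ge>0. (f has_real_derivative f' x) (at x within {0..})) \<and>
               (\<forall>x\<ge>0. (f' has_real_derivative f'' x) (at x within {0..})) \<and>
               continuous_on {0..} f'')"

text \<open>Convergence of the interaction sum is part of being a solution, as \<open>infsum\<close> is \<open>0\<close> for
  families that are not summable.\<close>

definition dnls_solution ::
  "(nat \<Rightarrow> real) \<Rightarrow> (real \<Rightarrow> real) \<Rightarrow> (int \<Rightarrow> real \<Rightarrow> complex) \<Rightarrow> bool" where
  "dnls_solution a f u \<longleftrightarrow>
     (\<forall>n t. u n differentiable (at t) \<and>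
        (\<lambda>l. of_real (a l) * (u (n + int l) t + u (n - int l) t - 2 * u n t)) summable_on {1..} \<and>
        \<i> * vector_derivative (u n) (at t) =
          (\<Sum>\<^sub>\<infinity>l\<in>{1..}. of_real (a l) * (u (n + int l) t + u (n - int l) t - 2 * u n t))
          + of_real (f ((cmod (u n t))\<^sup>2)) * u n t)"

definition travelling_wave :: "(real \<Rightarrow> complex) \<Rightarrow> real \<Rightarrow> int \<Rightarrow> real \<Rightarrow> complex" where
  "travelling_wave U v = (\<lambda>n t. U (real_of_int n - v * t))"

text \<open>The equation is invariant under phase rotations and shifts of the profile; profiles are
  counted as different only if they are not related by these symmetries.\<close>

definition symmetry_related :: "(real \<Rightarrow> complex) \<Rightarrow> (real \<Rightarrow> complex) \<Rightarrow> bool" where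
  "symmetry_related U W \<longleftrightarrow> (\<exists>\<theta> s :: real. \<forall>z. W z = cis \<theta> * U (z + s))"

end

theory Submission
  imports Defs
begin

text \<open>Plane waves \<open>U(z) = A e\<^sup>i\<^sup>\<kappa>\<^sup>z\<close> with \<open>\<kappa> = 2\<pi>(r\<^sub>1 + k)/T\<close> solve the equation exactly when
  the velocity is \<open>f(A\<^sup>2)/\<kappa> - \<Phi>(\<kappa>)\<close>. So for velocity \<open>\<nu> + s\<close> the branch of a solution
  \<open>k\<^sub>j\<close> needs an amplitude with \<open>f(A\<^sub>j\<^sup>2) = s \<kappa>\<^sub>j\<close>. All \<open>\<kappa>\<^sub>j\<close> have the same sign, so the
  right-hand sides have one common sign, which \<open>s\<close> controls; the intermediate value theorem
  provides small \<open>A\<^sub>j\<close> if \<open>f\<close> takes values of that sign arbitrarily close to \<open>0\<close>. If \<open>f\<close> takes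
  neither sign, it vanishes near \<open>0\<close> and \<open>s = 0\<close> works with every small amplitude.\<close>

section \<open>Small amplitudes with prescribed values of the nonlinearity\<close>

text \<open>The choice for \<open>h y\<close> is the first point where \<open>g\<close> reaches the
  level \<open>y\<close>. This point tends to 0 with \<open>y\<close>, because \<open>g\<close>
  reaches some positive level before any given \<open>x > 0\<close>.\<close>

lemma small_right_inverse:
  fixes g :: "real \<Rightarrow> real"
  assumes cont: "continuous_on {0..} g" and g0: "g 0 = 0"
    and pos: "\<And>\<delta>. \<delta> > 0 \<Longrightarrow> \<exists>x. 0 < x \<and> x < \<delta> \<and> g x > 0"
  shows "\<exists>\<eta> h. \<eta> > 0 \<and> (\<forall>y. 0 < y \<longrightarrow> y < \<eta> \<longrightarrow> h y > 0 \<and> g (h y) = y) \<and>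
    (h \<longlongrightarrow> 0) (at_right 0)"
proof -
  obtain x1 where x1: "0 < x1" "g x1 > 0" using pos[of 1] by auto
  \<comment> \<open>Superlevel sets of a continuous function are closed, so the infimum is attained
    once the set is nonempty; \<open>x1\<close> lies in it for all \<open>y < g x1\<close>.\<close>
  define S where "S y = {x\<in>{0..}. y \<le> g x}" for y
  define h where "h y = Inf (S y)" for y
  have bdd: "bdd_below (S y)" for y by (auto simp: S_def bdd_below_def)
  have main: "h y > 0 \<and> g (h y) = y" if y: "0 < y" "y < g x1" for y
  proof -
    have "closed (S y)" unfolding S_def
      by (intro continuous_on_closed_Collect_le cont continuous_intros)
    moreover have "S y \<noteq> {}" using x1 y by (auto simp: S_def intro!: exI[of _ x1])
    ultimately have hS: "h y \<in> S y" unfolding h_def by (intro closed_contains_Inf bdd)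
    \<comment> \<open>The value \<open>y\<close> is already attained on \<open>[0, h y]\<close>;
      minimality of \<open>h y\<close> forces this to happen at \<open>h y\<close> itself.\<close>
    have "\<exists>x\<ge>0. x \<le> h y \<and> g x = y"
      using hS y g0 by (intro IVT' continuous_on_subset[OF cont]) (auto simp: S_def)
    then obtain x where x: "x \<ge> 0" "x \<le> h y" "g x = y" by blast
    have "h y \<le> x" unfolding h_def using x by (intro cInf_lower bdd) (auto simp: S_def)
    hence "g (h y) = y" using x by simp
    moreover have "h y \<noteq> 0" using calculation y g0 by auto
    ultimately show ?thesis using hS by (auto simp: S_def)
  qed
  have "(h \<longlongrightarrow> 0) (at_right 0)"
  proof (rule tendstoI)
    fix e :: real assume "e > 0"
    then obtain x where x: "0 < x" "x < e" "g x > 0" using pos by blast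
    \<comment> \<open>Below the level \<open>g x\<close> the point \<open>x\<close> belongs to
      \<open>S y\<close>, which gives \<open>h y \<le> x < e\<close>; below \<open>g x1\<close> also
      \<open>h y > 0\<close>.\<close>
    have "\<forall>\<^sub>F y in at_right 0. y \<in> {0<..<min (g x) (g x1)}"
      using x x1 by (intro eventually_at_right_real) auto
    thus "\<forall>\<^sub>F y in at_right 0. dist (h y) 0 < e"
    proof eventually_elim
      case (elim y)
      hence "h y \<le> x" unfolding h_def using x by (intro cInf_lower bdd) (auto simp: S_def)
      thus ?case using main[of y] elim x by auto
    qed
  qed
  thus ?thesis using x1 main by (intro exI[of _ "g x1"] exI[of _ h]) auto
qed

text \<open>The factor \<open>\<tau>\<close> is 1, -1 or 0 according to whether \<open>f\<close>
  takes positive values, negative values or only 0 close to the origin on the right. This lets the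
  three cases be treated uniformly later on. Square roots appear since \<open>f\<close> is evaluated
  at squared amplitudes.\<close>

lemma small_amplitudes:
  fixes f :: "real \<Rightarrow> real"
  assumes cont: "continuous_on {0..} f" and f0: "f 0 = 0"
  obtains \<tau> \<eta> h where "\<bar>\<tau>\<bar> \<le> (1::real)" "\<eta> > 0"
    "\<And>y. 0 < y \<Longrightarrow> y < \<eta> \<Longrightarrow> h y > 0 \<and> f ((h y)\<^sup>2) = \<tau> * y" "(h \<longlongrightarrow> 0) (at_right 0)"
proof -
  have sqrt_lim: "((\<lambda>y. sqrt (h y)) \<longlongrightarrow> 0) (at_right 0)"
    if "(h \<longlongrightarrow> 0) (at_right 0)" for h :: "real \<Rightarrow> real"
    using tendsto_real_sqrt[OF that] by simp
  consider "\<forall>\<delta>>0. \<exists>x. 0 < x \<and> x < \<delta> \<and> f x > 0" | "\<forall>\<delta>>0. \<exists>x. 0 < x \<and> x < \<delta> \<and> - f x > 0"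
    | \<delta> where "\<delta> > 0" "\<And>x. 0 < x \<Longrightarrow> x < \<delta> \<Longrightarrow> f x = 0"
  proof -
    have "\<exists>\<delta>>0. \<forall>x. 0 < x \<and> x < \<delta> \<longrightarrow> f x = 0"
      if "\<delta>1 > 0" "\<And>x. 0 < x \<and> x < \<delta>1 \<Longrightarrow> \<not> f x > 0"
        "\<delta>2 > 0" "\<And>x. 0 < x \<and> x < \<delta>2 \<Longrightarrow> \<not> f x < 0" for \<delta>1 \<delta>2
      using that by (intro exI[of _ "min \<delta>1 \<delta>2"]) (auto intro: antisym simp: not_less)
    thus ?thesis using that by (metis neg_0_less_iff_less)
  qed
  thus ?thesis
  proof cases
    case 1
    then obtain \<eta> h where *: "\<eta> > 0" "\<And>y. 0 < y \<Longrightarrow> y < \<eta> \<Longrightarrow> h y > 0 \<and> f (h y) = y"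
      "(h \<longlongrightarrow> 0) (at_right 0)"
      using small_right_inverse[OF cont f0] 1 by blast
    show ?thesis
      by (rule that[of 1 \<eta> "\<lambda>y. sqrt (h y)"]) (use * sqrt_lim in \<open>auto simp: less_imp_le\<close>)
  next
    case 2
    then obtain \<eta> h where *: "\<eta> > 0" "\<And>y. 0 < y \<Longrightarrow> y < \<eta> \<Longrightarrow> h y > 0 \<and> - f (h y) = y"
      "(h \<longlongrightarrow> 0) (at_right 0)"
      using small_right_inverse[OF continuous_on_minus[OF cont]] f0 2 by force
    show ?thesis
      by (rule that[of "-1" \<eta> "\<lambda>y. sqrt (h y)"]) (use * sqrt_lim in \<open>auto simp: less_imp_le minus_equation_iff\<close>)
  next
    case 3
    show ?thesis
      \<comment> \<open>For \<open>0 < y < \<delta>\<close> the square of \<open>sqrt y\<close> lies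
        where \<open>f\<close> vanishes.\<close>
      by (rule that[of 0 \<delta> "\<lambda>y. sqrt y"]) (use 3 sqrt_lim[of "\<lambda>y. y"] in \<open>auto simp: less_imp_le\<close>)
  qed
qed

section \<open>Plane waves and their dispersion relation\<close>

definition plane_wave :: "real \<Rightarrow> real \<Rightarrow> real \<Rightarrow> complex" where
  "plane_wave \<kappa> A z = of_real A * cis (\<kappa> * z)"

lemma norm_plane_wave [simp]: "norm (plane_wave \<kappa> A z) = \<bar>A\<bar>"
  by (simp add: plane_wave_def norm_mult)

lemma plane_wave_add: "plane_wave \<kappa> A (z + w) = cis (\<kappa> * w) * plane_wave \<kappa> A z"
  by (simp add: plane_wave_def cis_mult algebra_simps)

lemma plane_wave_has_vector_derivative:
  "(plane_wave \<kappa> A has_vector_derivative \<i> * of_real \<kappa> * plane_wave \<kappa> A z) (at z)"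
  unfolding plane_wave_def has_vector_derivative_def
  by (auto intro!: derivative_eq_intros ext simp: scaleR_conv_of_real algebra_simps)

lemma plane_wave_C1: "plane_wave \<kappa> A C1_differentiable_on UNIV"
proof -
  have "continuous_on UNIV (plane_wave \<kappa> A)"
    unfolding plane_wave_def by (intro continuous_intros)
  thus ?thesis
    unfolding C1_differentiable_on_def
    by (intro exI[of _ "\<lambda>z. \<i> * of_real \<kappa> * plane_wave \<kappa> A z"] conjI ballI
        plane_wave_has_vector_derivative continuous_intros) auto
qed

text \<open>Shifts multiply a plane wave by constants, and the half-angle formula turns
  \<open>2 cos - 2\<close> into the squared sine that occurs in \<open>Phi\<close>.\<close>

lemma plane_wave_second_difference:
  "plane_wave \<kappa> A (z + l) + plane_wave \<kappa> A (z - l) - 2 * plane_wave \<kappa> A z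
     = of_real (- 4 * (sin (\<kappa> * l / 2))\<^sup>2) * plane_wave \<kappa> A z"
proof -
  have "cos (\<kappa> * l) = 1 - 2 * (sin (\<kappa> * l / 2))\<^sup>2"
    using cos_double_sin[of "\<kappa> * l / 2"] by simp
  hence "cis (\<kappa> * l) + cis (\<kappa> * - l) - 2 = of_real (- 4 * (sin (\<kappa> * l / 2))\<^sup>2)"
    by (simp add: complex_eq_iff)
  thus ?thesis
    using plane_wave_add[of \<kappa> A z l] plane_wave_add[of \<kappa> A z "- l"]
    by (metis (no_types, lifting) diff_conv_add_uminus distrib_right left_diff_distrib)
qed

text \<open>A plane wave is an eigenfunction of differentiation and of every second difference, and
  its modulus is constant. The lattice equation thus reduces to the scalar identity
  \<open>\<kappa> * V = f (A\<^sup>2) - \<kappa> * Phi a \<kappa>\<close>.\<close>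

lemma dnls_solution_plane_wave:
  assumes a: "(\<lambda>j. \<bar>a j\<bar>) summable_on {1..}" and \<kappa>: "\<kappa> \<noteq> 0"
    and V: "V = f (A\<^sup>2) / \<kappa> - Phi a \<kappa>"
  shows "dnls_solution a f (travelling_wave (plane_wave \<kappa> A) V)"
  unfolding dnls_solution_def
proof (intro allI)
  fix n :: int and t :: real
  define u where "u = travelling_wave (plane_wave \<kappa> A) V"
  define b where "b l = a l * (sin (\<kappa> * real l / 2))\<^sup>2" for l
  have bsum: "b summable_on {1..}"
  proof (rule abs_summable_summable[OF Infinite_Sum.abs_summable_on_comparison_test])
    show "(\<lambda>j. norm (a j)) summable_on {1..}" using a by simp
    fix l
    have "(sin (\<kappa> * real l / 2))\<^sup>2 \<le> 1" by (simp add: abs_square_le_1)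
    thus "norm (b l) \<le> norm (a l)"
      by (simp add: b_def abs_mult mult_left_le)
  qed
  have der: "(u n has_vector_derivative - (\<i> * of_real (\<kappa> * V)) * u n t) (at t)"
  proof -
    have "((\<lambda>t. real_of_int n - V * t) has_vector_derivative - V) (at t)"
      by (auto intro!: derivative_eq_intros)
    from vector_diff_chain_at[OF this plane_wave_has_vector_derivative[of \<kappa> A]]
    show ?thesis
      by (simp add: u_def travelling_wave_def o_def scaleR_conv_of_real mult_ac)
  qed
  have term_eq: "of_real (a l) * (u (n + int l) t + u (n - int l) t - 2 * u n t)
      = of_real (b l) * (- 4 * u n t)" for l
  proof -
    have "u (n + int l) t + u (n - int l) t - 2 * u n t
        = of_real (- 4 * (sin (\<kappa> * real l / 2))\<^sup>2) * u n t"
      using plane_wave_second_difference[of \<kappa> A "real_of_int n - V * t" "real l"]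
      by (simp add: u_def travelling_wave_def algebra_simps)
    thus ?thesis by (simp add: b_def)
  qed
  have "(b has_sum infsum b {1..}) {1..}" using bsum by simp
  hence "((\<lambda>l. of_real (b l) * (- 4 * u n t)) has_sum of_real (infsum b {1..}) * (- 4 * u n t)) {1..}"
    by (intro has_sum_cmult_left has_sum_of_real)
  hence hs: "((\<lambda>l. of_real (a l) * (u (n + int l) t + u (n - int l) t - 2 * u n t))
      has_sum of_real (infsum b {1..}) * (- 4 * u n t)) {1..}"
    by (simp only: term_eq)
  \<comment> \<open>The factor \<open>\<kappa>\<close> cancels the \<open>1 / x\<close> in
    \<open>Phi\<close>.\<close>
  have "4 * infsum b {1..} = \<kappa> * Phi a \<kappa>" using \<kappa> by (simp add: Phi_def b_def[abs_def])
  hence "\<kappa> * V = - 4 * infsum b {1..} + f (A\<^sup>2)" using \<kappa> by (simp add: V field_simps)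
  hence "\<i> * (- (\<i> * of_real (\<kappa> * V)) * u n t) = of_real (- 4 * infsum b {1..} + f (A\<^sup>2)) * u n t"
    by (simp add: left_diff_distrib flip: mult.assoc)
  also have "\<dots> = of_real (infsum b {1..}) * (- 4 * u n t) + of_real (f (A\<^sup>2)) * u n t"
    by (simp add: algebra_simps)
  also have "A\<^sup>2 = (cmod (u n t))\<^sup>2"
    by (simp add: u_def travelling_wave_def)
  finally have "\<i> * (- (\<i> * of_real (\<kappa> * V)) * u n t)
      = of_real (infsum b {1..}) * (- 4 * u n t) + of_real (f ((cmod (u n t))\<^sup>2)) * u n t" .
  thus "u n differentiable (at t) \<and>
        (\<lambda>l. of_real (a l) * (u (n + int l) t + u (n - int l) t - 2 * u n t)) summable_on {1..} \<and>
        \<i> * vector_derivative (u n) (at t) =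
          (\<Sum>\<^sub>\<infinity>l\<in>{1..}. of_real (a l) * (u (n + int l) t + u (n - int l) t - 2 * u n t))
          + of_real (f ((cmod (u n t))\<^sup>2)) * u n t"
    using differentiableI_vector[OF der] has_sum_imp_summable[OF hs]
    by (simp only: infsumI[OF hs] vector_derivative_at[OF der] simp_thms)
qed

section \<open>Plane waves up to symmetry\<close>

text \<open>Rotating the phase or shifting the argument changes only the constant factor of a plane
  wave, so the wave number is an invariant of nonzero profiles.\<close>

lemma symmetry_related_plane_wave:
  assumes rel: "symmetry_related (plane_wave \<kappa> A) (plane_wave \<mu> B)" and "B \<noteq> 0"
  shows "\<kappa> = \<mu>"
proof (rule ccontr)
  assume "\<kappa> \<noteq> \<mu>"
  \<comment> \<open>At this point the phases \<open>\<kappa> * z\<close> and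
    \<open>\<mu> * z\<close> differ by \<open>pi\<close>, so the two exponentials are
    opposite.\<close>
  define z where "z = pi / (\<kappa> - \<mu>)"
  obtain \<theta> s where eq: "plane_wave \<mu> B z = cis \<theta> * plane_wave \<kappa> A (z + s)" for z
    using rel unfolding symmetry_related_def by blast
  have "cis (\<mu> * z) * plane_wave \<mu> B 0 = plane_wave \<mu> B z"
    using plane_wave_add[of \<mu> B 0 z] by simp
  also have "\<dots> = cis (\<kappa> * z) * plane_wave \<mu> B 0"
    using eq[of z] eq[of 0] plane_wave_add[of \<kappa> A s z] by (simp add: add.commute)
  finally have "cis (\<mu> * z) = cis (\<kappa> * z)"
    using \<open>B \<noteq> 0\<close> by (simp add: plane_wave_def)
  moreover have "\<kappa> * z = pi + \<mu> * z"
    using \<open>\<kappa> \<noteq> \<mu>\<close> by (simp add: z_def field_simps)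
  hence "cis (\<kappa> * z) = - cis (\<mu> * z)" by (simp flip: cis_mult)
  ultimately show False using cis_neq_zero[of "\<mu> * z"] by auto
qed

section \<open>Construction of the branches\<close>

theorem theorem1p2:
  fixes a :: "nat \<Rightarrow> real" and f :: "real \<Rightarrow> real"
    and r1 \<nu> T :: real and m1 :: nat
  assumes "\<exists>j\<ge>1. a j \<noteq> 0"
    and "(\<lambda>j. \<bar>a j\<bar>) summable_on {1..}"
    and "C2_on_nonneg f" and "f 0 = 0"
    and "r1 \<in> {0<..<1}"
    and "\<nu> \<in> Phi a ` (UNIV - {0}) - {0}"
    and "T > 0"
    and "m1 = card {k :: int. - \<nu> = Phi a (2 * pi / T * (r1 + real_of_int k))}"
    and "m1 > 0"
    and "(\<forall>k :: int. - \<nu> = Phi a (2 * pi / T * (r1 + real_of_int k)) \<longrightarrow> k \<ge> 0) \<or>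
         (\<forall>k :: int. - \<nu> = Phi a (2 * pi / T * (r1 + real_of_int k)) \<longrightarrow> k < 0)"
  shows "\<exists>\<epsilon>\<^sub>0 > 0. \<exists>(U :: nat \<Rightarrow> real \<Rightarrow> real \<Rightarrow> complex) (V :: real \<Rightarrow> real).
      (\<forall>\<epsilon>\<in>{0<..<\<epsilon>\<^sub>0}. V \<epsilon> \<noteq> 0 \<and>
        (\<forall>j\<in>{1..m1}.
           U j \<epsilon> C1_differentiable_on UNIV \<and>
           (\<exists>z. U j \<epsilon> z \<noteq> 0) \<and>
           (\<forall>z. U j \<epsilon> (z + T) = exp (2 * of_real pi * of_real r1 * \<i>) * U j \<epsilon> z) \<and>
           dnls_solution a f (travelling_wave (U j \<epsilon>) (V \<epsilon>)))) \<and>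
      (\<forall>i\<in>{1..m1}. \<forall>j\<in>{1..m1}. i \<noteq> j \<longrightarrow>
        (\<forall>\<epsilon>\<in>{0<..<\<epsilon>\<^sub>0}. \<forall>\<delta>\<in>{0<..<\<epsilon>\<^sub>0}. \<not> symmetry_related (U i \<epsilon>) (U j \<delta>))) \<and>
      (V \<longlongrightarrow> \<nu>) (at_right 0) \<and>
      (\<forall>j\<in>{1..m1}. uniform_limit UNIV (U j) (\<lambda>_. 0) (at_right 0))"
proof -
  define K where "K = {k :: int. - \<nu> = Phi a (2 * pi / T * (r1 + real_of_int k))}"
  \<comment> \<open>An infinite set has \<open>card\<close> equal to 0, so \<open>m1 > 0\<close>
    yields finiteness.\<close>
  have finK: "finite K" and m1: "m1 = card K"
    using assms(8,9) card_gt_0_iff by (auto simp: K_def)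
  then obtain k where k: "bij_betw k {1..m1} K"
    using ex_bij_betw_nat_finite_1 by blast
  define \<kappa> where "\<kappa> j = 2 * pi / T * (r1 + real_of_int (k j))" for j
  have Phi: "Phi a (\<kappa> j) = - \<nu>" if "j \<in> {1..m1}" for j
    using bij_betwE[OF k] that by (auto simp: K_def \<kappa>_def)
  have sgn_\<kappa>: "\<exists>\<rho>. \<bar>\<rho>\<bar> = 1 \<and> (\<forall>j\<in>{1..m1}. sgn (\<kappa> j) = \<rho>)"
    using assms(10)
  proof
    assume *: "\<forall>k. - \<nu> = Phi a (2 * pi / T * (r1 + real_of_int k)) \<longrightarrow> k \<ge> 0"
    have "\<kappa> j > 0" if "j \<in> {1..m1}" for j
    proof -
      have "k j \<ge> 0" using * bij_betwE[OF k] that by (auto simp: K_def)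
      hence "r1 + real_of_int (k j) > 0" using assms(5) by (simp add: add_pos_nonneg)
      thus ?thesis using assms(7) by (simp add: \<kappa>_def)
    qed
    thus ?thesis by (intro exI[of _ 1]) auto
  next
    assume *: "\<forall>k. - \<nu> = Phi a (2 * pi / T * (r1 + real_of_int k)) \<longrightarrow> k < 0"
    have "\<kappa> j < 0" if "j \<in> {1..m1}" for j
    proof -
      \<comment> \<open>Integrality leaves a gap of 1 below zero, which \<open>r1 < 1\<close> cannot
        close.\<close>
      have "k j \<le> - 1" using * bij_betwE[OF k] that by (force simp: K_def)
      hence "real_of_int (k j) \<le> - 1" by linarith
      hence "r1 + real_of_int (k j) < 0" using assms(5) by simp
      thus ?thesis using assms(7) by (simp add: \<kappa>_def mult_pos_neg divide_neg_pos)
    qed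
    thus ?thesis by (intro exI[of _ "- 1"]) auto
  qed
  then obtain \<rho> where \<rho>: "\<bar>\<rho>\<bar> = 1" "\<And>j. j \<in> {1..m1} \<Longrightarrow> sgn (\<kappa> j) = \<rho>" by blast
  have \<kappa>0: "\<kappa> j \<noteq> 0" if "j \<in> {1..m1}" for j using \<rho>(1) \<rho>(2)[OF that] by auto
  have "continuous_on {0..} f"
  proof -
    obtain f' where "\<forall>x\<ge>0. (f has_real_derivative f' x) (at x within {0..})"
      using assms(3) unfolding C2_on_nonneg_def by blast
    thus ?thesis by (intro DERIV_continuous_on[where D = f']) auto
  qed
  with assms(4) obtain \<tau> \<eta> h where h: "\<bar>\<tau>\<bar> \<le> (1::real)" "\<eta> > 0"
    "\<And>y. 0 < y \<Longrightarrow> y < \<eta> \<Longrightarrow> h y > 0 \<and> f ((h y)\<^sup>2) = \<tau> * y" "(h \<longlongrightarrow> 0) (at_right 0)"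
    using small_amplitudes by metis
  \<comment> \<open>A common bound for all wave numbers; the summand 1 makes it visibly
    positive.\<close>
  define M where "M = (\<Sum>j\<in>{1..m1}. \<bar>\<kappa> j\<bar>) + 1"
  have M: "\<bar>\<kappa> j\<bar> \<le> M" if "j \<in> {1..m1}" for j
    unfolding M_def using member_le_sum[of j "{1..m1}" "\<lambda>j. \<bar>\<kappa> j\<bar>"] that by simp
  have "M > 0" unfolding M_def by (simp add: sum_nonneg add_nonneg_pos)
  have "\<nu> \<noteq> 0" using assms(6) by simp
  \<comment> \<open>The first bound keeps every \<open>\<bar>\<kappa> j\<bar> * \<epsilon>\<close>
    below \<open>\<eta>\<close>, where \<open>h\<close> is controlled; the second keeps the velocity
    shift smaller than \<open>\<bar>\<nu>\<bar>\<close>, hence \<open>V \<epsilon>\<close>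
    nonzero.\<close>
  define \<epsilon>0 where "\<epsilon>0 = min (\<eta> / M) \<bar>\<nu>\<bar>"
  \<comment> \<open>With this amplitude \<open>f\<close> takes the value
    \<open>\<tau> * \<bar>\<kappa> j\<bar> * \<epsilon>\<close>. Division by
    \<open>\<kappa> j\<close> leaves \<open>\<tau> * \<rho> * \<epsilon>\<close>, the same velocity
    shift for every branch because the sign \<open>\<rho>\<close> is common.\<close>
  define A where "A j \<epsilon> = h (\<bar>\<kappa> j\<bar> * \<epsilon>)" for j \<epsilon>
  define U where "U j \<epsilon> = plane_wave (\<kappa> j) (A j \<epsilon>)" for j \<epsilon>
  define V where "V \<epsilon> = \<nu> + \<tau> * \<rho> * \<epsilon>" for \<epsilon>
  have A: "A j \<epsilon> > 0 \<and> f ((A j \<epsilon>)\<^sup>2) = \<tau> * (\<rho> * \<kappa> j) * \<epsilon>"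
    if "j \<in> {1..m1}" "\<epsilon> \<in> {0<..<\<epsilon>0}" for j \<epsilon>
  proof -
    have "\<bar>\<kappa> j\<bar> * \<epsilon> \<le> M * \<epsilon>" using M[OF that(1)] that by (intro mult_right_mono) auto
    also have "\<dots> < \<eta>" using that \<open>M > 0\<close> by (simp add: \<epsilon>0_def field_simps)
    finally have "A j \<epsilon> > 0 \<and> f ((A j \<epsilon>)\<^sup>2) = \<tau> * (\<bar>\<kappa> j\<bar> * \<epsilon>)"
      unfolding A_def using that \<kappa>0 by (intro h(3)) auto
    moreover have "\<bar>\<kappa> j\<bar> = \<rho> * \<kappa> j" using \<rho>(2)[OF that(1)] by (metis abs_sgn mult.commute)
    ultimately show ?thesis by (simp add: mult.assoc)
  qed
  have sols: "V \<epsilon> \<noteq> 0 \<and> (\<forall>j\<in>{1..m1}. U j \<epsilon> C1_differentiable_on UNIV \<and> (\<exists>z. U j \<epsilon> z \<noteq> 0) \<and>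
      (\<forall>z. U j \<epsilon> (z + T) = exp (2 * of_real pi * of_real r1 * \<i>) * U j \<epsilon> z) \<and>
      dnls_solution a f (travelling_wave (U j \<epsilon>) (V \<epsilon>)))" if \<epsilon>: "\<epsilon> \<in> {0<..<\<epsilon>0}" for \<epsilon>
  proof (intro conjI ballI allI)
    have "\<bar>\<tau> * \<rho> * \<epsilon>\<bar> \<le> \<epsilon>" using h(1) \<rho>(1) \<epsilon> by (simp add: abs_mult mult_left_le_one_le)
    also have "\<dots> < \<bar>\<nu>\<bar>" using \<epsilon> by (simp add: \<epsilon>0_def)
    finally show "V \<epsilon> \<noteq> 0" unfolding V_def by linarith
  next
    fix j assume j: "j \<in> {1..m1}"
    show "U j \<epsilon> C1_differentiable_on UNIV" by (simp add: U_def plane_wave_C1)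
    have "norm (U j \<epsilon> 0) \<noteq> 0" using A[OF j \<epsilon>] by (simp add: U_def)
    thus "\<exists>z. U j \<epsilon> z \<noteq> 0" by auto
    \<comment> \<open>Over one period the integer \<open>k j\<close> contributes only full turns, so
      all branches share the multiplier determined by \<open>r1\<close>.\<close>
    have "\<kappa> j * T = 2 * pi * r1 + 2 * pi * real_of_int (k j)"
      using assms(7) by (simp add: \<kappa>_def field_simps)
    hence "cis (\<kappa> j * T) = cis (2 * pi * r1) * cis (2 * pi * real_of_int (k j))"
      by (simp only: cis_mult)
    also have "\<dots> = cis (2 * pi * r1)" by (simp add: cis_multiple_2pi)
    finally have "cis (\<kappa> j * T) = exp (2 * of_real pi * of_real r1 * \<i>)"
      by (simp add: cis_conv_exp mult_ac)
    thus "U j \<epsilon> (z + T) = exp (2 * of_real pi * of_real r1 * \<i>) * U j \<epsilon> z" for z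
      by (simp add: U_def plane_wave_add)
    have "V \<epsilon> = f ((A j \<epsilon>)\<^sup>2) / \<kappa> j - Phi a (\<kappa> j)"
      using A[OF j \<epsilon>] \<kappa>0[OF j] Phi[OF j] by (simp add: V_def)
    thus "dnls_solution a f (travelling_wave (U j \<epsilon>) (V \<epsilon>))"
      unfolding U_def by (intro dnls_solution_plane_wave assms(2) \<kappa>0 j)
  qed
  \<comment> \<open>The wave number of a branch does not depend on the parameter, so different
    branches stay unrelated even at different parameter values.\<close>
  have distinct: "\<not> symmetry_related (U i \<epsilon>) (U j \<delta>)"
    if ij: "i \<in> {1..m1}" "j \<in> {1..m1}" "i \<noteq> j" and "\<delta> \<in> {0<..<\<epsilon>0}" for i j \<epsilon> \<delta>
  proof
    assume "symmetry_related (U i \<epsilon>) (U j \<delta>)"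
    hence "\<kappa> i = \<kappa> j"
      unfolding U_def using A[OF ij(2) that(4)] by (intro symmetry_related_plane_wave) auto
    hence "k i = k j" using assms(7) by (simp add: \<kappa>_def)
    thus False using ij bij_betw_imp_inj_on[OF k] by (auto dest: inj_onD)
  qed
  have "(V \<longlongrightarrow> \<nu> + \<tau> * \<rho> * 0) (at_right 0)"
    unfolding V_def by (intro tendsto_intros)
  hence lim_V: "(V \<longlongrightarrow> \<nu>) (at_right 0)" by simp
  have lim_U: "uniform_limit UNIV (U j) (\<lambda>_. 0) (at_right 0)" if j: "j \<in> {1..m1}" for j
  proof (rule uniform_limitI)
    fix e :: real assume "e > 0"
    \<comment> \<open>Since \<open>\<kappa> j\<close> is nonzero, the argument of \<open>h\<close>
      approaches 0 through positive values. Uniformity in \<open>z\<close> is then automatic, as the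
      modulus of a plane wave is constant.\<close>
    have "filterlim (\<lambda>\<epsilon>. \<bar>\<kappa> j\<bar> * \<epsilon>) (at_right 0) (at_right 0)"
      using \<kappa>0[OF j] by (auto simp: filterlim_at intro!: tendsto_eq_intros
          intro: eventually_mono[OF eventually_at_right_less])
    from filterlim_compose[OF h(4) this]
    have "(A j \<longlongrightarrow> 0) (at_right 0)" by (simp add: A_def[abs_def])
    from tendstoD[OF this \<open>e > 0\<close>]
    show "\<forall>\<^sub>F \<epsilon> in at_right 0. \<forall>z\<in>UNIV. dist (U j \<epsilon> z) 0 < e"
      by (simp add: U_def)
  qed
  have "\<epsilon>0 > 0" using h(2) \<open>M > 0\<close> \<open>\<nu> \<noteq> 0\<close> by (simp add: \<epsilon>0_def)
  show ?thesis
    by (rule exI[of _ \<epsilon>0], rule conjI, fact, rule exI[of _ U], rule exI[of _ V], intro conjI)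
      (use sols distinct lim_V lim_U in blast)+
qed

end
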